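(* Let $m\ge 1$ be an iteration of the SCP-QCLP algorithm described in the context, let $s_1^{(m)},\ldots,s_N^{(m)}$ be the values of the decision variables at the beginning of iteration $m$, and let $\tilde\beta_0^{(m)},\tilde\beta_1^{(m)},\ldots,\tilde\beta_N^{(m)}$ be the corresponding coefficients defined in the context. Consider the optimization problem $$(\mathrm{P1}\text{-}m):\quad \max_{s_1\ge 0,\ldots,s_N\ge 0}\ \tilde\beta_0^{(m)}+\sum_{n=1}^{N}\tilde\beta_n^{(m)}\left(s_n-s_n^{(m)}\right)\quad\text{subject to}\quad \sum_{n=1}^{N}s_n^2\le P_T .$$ Then the optimal solution to $(\mathrm{P1}\text{-}m)$ is given by $$s_n=\tilde\beta_n^{(m)}\sqrt{\frac{P_T}{\sum_{k=1}^{N}\left(\tilde\beta_k^{(m)}\right)^2}},\qquad n=1,\ldots,N .$$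
   Context: Parameters. $N\ge 1$ is an integer; $P_T,R_s,\eta,V_0>0$ are real constants; $h_1,\ldots,h_N\ge 0$ are real numbers (channel amplitudes), not all zero. The frequency band is $[f_{\min},f_{\max}]$ with $0<f_{\min}<f_{\max}$. The frequencies are $f_n=f_0+(n-1)\Delta_f$, $n=1,\ldots,N$, where $\Delta_f>0$, $f_0\ge f_{\min}$, $f_0/\Delta_f$ is an integer, and $f_0+(N-1)\Delta_f\le f_{\max}$. Put $w_n=2\pi f_n$ and $T=1/\Delta_f$. Let $Q\ge 1$ be a (large) integer (number of sampling points per period) and $\Delta_t=T/Q$. Coefficients. Given $s_1^{(m)},\ldots,s_N^{(m)}\ge 0$, define $$z^{(m)}(t)=\exp\left(\frac{\sqrt{2R_s}\,\sum_{n=1}^{N}s_n^{(m)}h_n\cos(w_n t)}{\eta V_0}\right),\qquad \tilde\beta_0^{(m)}=\frac1Q\sum_{q=1}^{Q}z^{(m)}(q\Delta_t),$$ $$\tilde\beta_n^{(m)}=\frac1Q\sum_{q=1}^{Q}\frac{\sqrt{2R_s}}{\eta V_0}\,h_n\cos(w_n q\Delta_t)\,z^{(m)}(q\Delta_t),\qquad n=1,\ldots,N.$$ SCP-QCLP algorithm. The iterates are initialized by $s_n^{(1)}=\sqrt{P_T/N}$ for $n=1,\ldots,N$. At iteration $m=1,2,\ldots$, the coefficients $\tilde\beta_0^{(m)},\ldots,\tilde\beta_N^{(m)}$ are computed from $(s_n^{(m)})_n$, and the next iterate is set to $$s_n^{(m+1)}=\tilde\beta_n^{(m)}\sqrt{\frac{P_T}{\sum_{k=1}^{N}(\tilde\beta_k^{(m)})^2}},\qquad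 n=1,\ldots,N.$$ For a fixed threshold $\epsilon>0$, the algorithm terminates after iteration $m$ if $|\tilde\beta_0^{(m+1)}-\tilde\beta_0^{(m)}|/\tilde\beta_0^{(m)}\le\epsilon$, and otherwise continues to iteration $m+1$. *)

theory Defs
  imports Complex_Main
begin

text \<open>
  Vectors indexed by \<open>1, \<dots>, N\<close> are functions \<open>nat \<Rightarrow> real\<close> of which only the values on
  \<open>{1..N}\<close> are used.
\<close>

definition ang_freq :: "real \<Rightarrow> real \<Rightarrow> nat \<Rightarrow> real" where
  "ang_freq f\<^sub>0 \<Delta>f n = 2 * pi * (f\<^sub>0 + (real n - 1) * \<Delta>f)"

definition period :: "real \<Rightarrow> real" where
  "period \<Delta>f = 1 / \<Delta>f"

definition sampling_step :: "real \<Rightarrow> nat \<Rightarrow> real" where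
  "sampling_step \<Delta>f Q = period \<Delta>f / real Q"

definition zfun ::
  "nat \<Rightarrow> real \<Rightarrow> real \<Rightarrow> real \<Rightarrow> (nat \<Rightarrow> real) \<Rightarrow> real \<Rightarrow> real \<Rightarrow> (nat \<Rightarrow> real) \<Rightarrow> real \<Rightarrow> real" where
  "zfun N R\<^sub>s \<eta> V\<^sub>0 h f\<^sub>0 \<Delta>f s t =
     exp (sqrt (2 * R\<^sub>s) * (\<Sum>n=1..N. s n * h n * cos (ang_freq f\<^sub>0 \<Delta>f n * t)) / (\<eta> * V\<^sub>0))"

definition coeff_zero ::
  "nat \<Rightarrow> real \<Rightarrow> real \<Rightarrow> real \<Rightarrow> (nat \<Rightarrow> real) \<Rightarrow> real \<Rightarrow> real \<Rightarrow> nat \<Rightarrow> (nat \<Rightarrow> real) \<Rightarrow> real" where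
  "coeff_zero N R\<^sub>s \<eta> V\<^sub>0 h f\<^sub>0 \<Delta>f Q s =
     1 / real Q * (\<Sum>q=1..Q. zfun N R\<^sub>s \<eta> V\<^sub>0 h f\<^sub>0 \<Delta>f s (real q * sampling_step \<Delta>f Q))"

definition coeff ::
  "nat \<Rightarrow> real \<Rightarrow> real \<Rightarrow> real \<Rightarrow> (nat \<Rightarrow> real) \<Rightarrow> real \<Rightarrow> real \<Rightarrow> nat \<Rightarrow> (nat \<Rightarrow> real) \<Rightarrow> nat \<Rightarrow> real" where
  "coeff N R\<^sub>s \<eta> V\<^sub>0 h f\<^sub>0 \<Delta>f Q s n =
     1 / real Q * (\<Sum>q=1..Q. sqrt (2 * R\<^sub>s) / (\<eta> * V\<^sub>0) * h n
        * cos (ang_freq f\<^sub>0 \<Delta>f n * (real q * sampling_step \<Delta>f Q))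
        * zfun N R\<^sub>s \<eta> V\<^sub>0 h f\<^sub>0 \<Delta>f s (real q * sampling_step \<Delta>f Q))"

text \<open>
  The iterates are numbered from \<open>1\<close>; there is no equation (and no use) for index \<open>0\<close>.
  The recursion is total and does not look at the stopping rule, which enters through
  \<open>executes_iteration\<close> below.
\<close>

fun iterate ::
  "nat \<Rightarrow> real \<Rightarrow> real \<Rightarrow> real \<Rightarrow> real \<Rightarrow> (nat \<Rightarrow> real) \<Rightarrow> real \<Rightarrow> real \<Rightarrow> nat \<Rightarrow> nat \<Rightarrow> nat \<Rightarrow> real" where
  "iterate N P\<^sub>T R\<^sub>s \<eta> V\<^sub>0 h f\<^sub>0 \<Delta>f Q (Suc 0) = (\<lambda>n. sqrt (P\<^sub>T / real N))"
| "iterate N P\<^sub>T R\<^sub>s \<eta> V\<^sub>0 h f\<^sub>0 \<Delta>f Q (Suc (Suc m)) =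
     (let \<beta> = coeff N R\<^sub>s \<eta> V\<^sub>0 h f\<^sub>0 \<Delta>f Q (iterate N P\<^sub>T R\<^sub>s \<eta> V\<^sub>0 h f\<^sub>0 \<Delta>f Q (Suc m))
      in (\<lambda>n. \<beta> n * sqrt (P\<^sub>T / (\<Sum>k=1..N. (\<beta> k)\<^sup>2))))"

definition terminates_after ::
  "nat \<Rightarrow> real \<Rightarrow> real \<Rightarrow> real \<Rightarrow> real \<Rightarrow> (nat \<Rightarrow> real) \<Rightarrow> real \<Rightarrow> real \<Rightarrow> nat \<Rightarrow> real \<Rightarrow> nat \<Rightarrow> bool" where
  "terminates_after N P\<^sub>T R\<^sub>s \<eta> V\<^sub>0 h f\<^sub>0 \<Delta>f Q \<epsilon> m \<longleftrightarrow>
     (let b = (\<lambda>j. coeff_zero N R\<^sub>s \<eta> V\<^sub>0 h f\<^sub>0 \<Delta>f Q (iterate N P\<^sub>T R\<^sub>s \<eta> V\<^sub>0 h f\<^sub>0 \<Delta>f Q j))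
      in \<bar>b (m + 1) - b m\<bar> / b m \<le> \<epsilon>)"

definition executes_iteration ::
  "nat \<Rightarrow> real \<Rightarrow> real \<Rightarrow> real \<Rightarrow> real \<Rightarrow> (nat \<Rightarrow> real) \<Rightarrow> real \<Rightarrow> real \<Rightarrow> nat \<Rightarrow> real \<Rightarrow> nat \<Rightarrow> bool" where
  "executes_iteration N P\<^sub>T R\<^sub>s \<eta> V\<^sub>0 h f\<^sub>0 \<Delta>f Q \<epsilon> m \<longleftrightarrow>
     1 \<le> m \<and> (\<forall>j\<in>{1..<m}. \<not> terminates_after N P\<^sub>T R\<^sub>s \<eta> V\<^sub>0 h f\<^sub>0 \<Delta>f Q \<epsilon> j)"

definition feasible :: "nat \<Rightarrow> real \<Rightarrow> (nat \<Rightarrow> real) \<Rightarrow> bool" where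
  "feasible N P\<^sub>T s \<longleftrightarrow> (\<forall>n\<in>{1..N}. 0 \<le> s n) \<and> (\<Sum>n=1..N. (s n)\<^sup>2) \<le> P\<^sub>T"

definition objective ::
  "nat \<Rightarrow> real \<Rightarrow> (nat \<Rightarrow> real) \<Rightarrow> (nat \<Rightarrow> real) \<Rightarrow> (nat \<Rightarrow> real) \<Rightarrow> real" where
  "objective N \<beta>\<^sub>0 \<beta> s\<^sub>m s = \<beta>\<^sub>0 + (\<Sum>n=1..N. \<beta> n * (s n - s\<^sub>m n))"

end

theory Submission
  imports Defs
begin

text \<open>
  On the sampling grid every carrier is a discrete cosine of period \<open>Q\<close>, because \<open>f\<^sub>0 / \<Delta>f\<close> is an
  integer. Functions with nonnegative correlation against all discrete cosines are closed under
  multiplication by nonnegative combinations of discrete cosines, and the constant \<open>1\<close> is such a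
  function; expanding the exponential into its power series and keeping only the linear term bounds
  the coefficients \<open>\<beta> n\<close> from below by a nonnegative multiple of \<open>s n * (h n)\<^sup>2\<close>. Along the iteration
  they therefore stay nonnegative, and positive where \<open>h n > 0\<close>. The candidate \<open>x = \<lambda>\<beta>\<close> is thus
  feasible, and expanding \<open>\<Sum>(s n - x n)\<^sup>2\<close> shows that it is the unique maximizer.
\<close>

section \<open>Discrete cosines on the sampling grid\<close>

definition dcos :: "nat \<Rightarrow> int \<Rightarrow> nat \<Rightarrow> real" where
  "dcos Q M q = cos (2 * pi * of_int M * real q / real Q)"

lemma dcos_mult: "dcos Q M q * dcos Q L q = (dcos Q (M - L) q + dcos Q (M + L) q) / 2"
  by (simp add: dcos_def cos_times_cos left_diff_distrib distrib_right
      right_diff_distrib distrib_left diff_divide_distrib add_divide_distrib)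

lemma dcos_period: "1 \<le> Q \<Longrightarrow> dcos Q M Q = 1"
  using cos_int_2pin[of M] by (simp add: dcos_def)

text \<open>The summands are the real parts of the powers of a \<open>Q\<close>-th root of unity
  \<open>w\<close>. The sum is \<open>Q\<close> if \<open>w = 1\<close>; otherwise the geometric
  series over a full period vanishes.\<close>

lemma sum_dcos_nonneg:
  assumes "1 \<le> Q"
  shows "0 \<le> (\<Sum>q=1..Q. dcos Q M q)"
proof -
  define w where "w = cis (2 * pi * of_int M / real Q)"
  have wq: "Re (w ^ q) = dcos Q M q" for q
    by (simp add: w_def dcos_def DeMoivre mult_ac)
  have "w ^ Q = cis (2 * pi * of_int M)"
    using assms by (simp add: w_def DeMoivre)
  then have wQ: "w ^ Q = 1"
    by (simp add: cis_multiple_2pi)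
  show ?thesis
  proof (cases "w = 1")
    case True
    then have "dcos Q M q = 1" for q
      using wq[of q] by simp
    then show ?thesis by simp
  next
    case False
    have "(\<Sum>q=1..Q. w ^ q) = w * (\<Sum>q<Q. w ^ q)"
      by (simp add: sum_distrib_left sum.atLeast1_atMost_eq)
    also have "\<dots> = 0"
      using False wQ by (simp add: geometric_sum)
    finally have "Re (\<Sum>q=1..Q. w ^ q) = 0" by simp
    then show ?thesis by (simp add: wq)
  qed
qed

section \<open>Functions with nonnegative discrete cosine correlations\<close>

definition pos_corr :: "nat \<Rightarrow> (nat \<Rightarrow> real) \<Rightarrow> bool" where
  "pos_corr Q g \<longleftrightarrow> (\<forall>M. 0 \<le> (\<Sum>q=1..Q. dcos Q M q * g q))"

lemma pos_corrD: "pos_corr Q g \<Longrightarrow> 0 \<le> (\<Sum>q=1..Q. dcos Q M q * g q)"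
  by (simp add: pos_corr_def)

lemma pos_corr_one: "1 \<le> Q \<Longrightarrow> pos_corr Q (\<lambda>q. 1)"
  unfolding pos_corr_def using sum_dcos_nonneg by simp

text \<open>By the product-to-sum formula, multiplying by \<open>dcos Q L\<close> averages the
  correlations at the shifted frequencies \<open>M - L\<close> and \<open>M + L\<close>. Since
  \<open>M - L\<close> may be negative, \<open>pos_corr\<close> tests all integer
  frequencies.\<close>

lemma pos_corr_dcos_mult:
  assumes "pos_corr Q g"
  shows "pos_corr Q (\<lambda>q. dcos Q L q * g q)"
  unfolding pos_corr_def
proof
  fix M
  have "(\<Sum>q=1..Q. dcos Q M q * (dcos Q L q * g q))
      = (\<Sum>q=1..Q. (dcos Q (M - L) q * g q + dcos Q (M + L) q * g q) / 2)"
    by (intro sum.cong refl) (simp add: mult.assoc[symmetric] dcos_mult distrib_right)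
  also have "\<dots> = ((\<Sum>q=1..Q. dcos Q (M - L) q * g q) + (\<Sum>q=1..Q. dcos Q (M + L) q * g q)) / 2"
    by (simp add: sum_divide_distrib[symmetric] sum.distrib)
  finally show "0 \<le> (\<Sum>q=1..Q. dcos Q M q * (dcos Q L q * g q))"
    using pos_corrD[OF assms, of "M - L"] pos_corrD[OF assms, of "M + L"] by simp
qed

lemma pos_corr_sum:
  assumes "\<And>k. k \<in> A \<Longrightarrow> 0 \<le> a k" and "\<And>k. k \<in> A \<Longrightarrow> pos_corr Q (g k)"
  shows "pos_corr Q (\<lambda>q. \<Sum>k\<in>A. a k * g k q)"
  unfolding pos_corr_def
proof
  fix M
  have "(\<Sum>q=1..Q. dcos Q M q * (\<Sum>k\<in>A. a k * g k q))
      = (\<Sum>k\<in>A. a k * (\<Sum>q=1..Q. dcos Q M q * g k q))"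
    unfolding sum_distrib_left by (subst sum.swap) (simp add: mult_ac)
  also have "0 \<le> \<dots>"
    by (intro sum_nonneg mult_nonneg_nonneg pos_corrD assms)
  finally show "0 \<le> (\<Sum>q=1..Q. dcos Q M q * (\<Sum>k\<in>A. a k * g k q))" .
qed

lemma pos_corr_power:
  assumes "1 \<le> Q" and "\<And>k. k \<in> A \<Longrightarrow> 0 \<le> a k"
  shows "pos_corr Q (\<lambda>q. (\<Sum>k\<in>A. a k * dcos Q (F k) q) ^ i)"
proof (induction i)
  case 0
  then show ?case using assms(1) by (simp add: pos_corr_one)
next
  case (Suc i)
  have "pos_corr Q (\<lambda>q. \<Sum>k\<in>A. a k * (dcos Q (F k) q * (\<Sum>k\<in>A. a k * dcos Q (F k) q) ^ i))"
    by (intro pos_corr_sum assms(2) pos_corr_dcos_mult Suc)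
  then show ?case
    by (simp add: sum_distrib_right mult.assoc)
qed

text \<open>Correlating the exponential series term by term gives a convergent series whose terms
  are all nonnegative by assumption, so its sum is at least the term \<open>i = 1\<close>.\<close>

lemma corr_exp_ge_linear:
  assumes "\<And>i. pos_corr Q (\<lambda>q. u q ^ i)"
  shows "(\<Sum>q=1..Q. dcos Q M q * u q) \<le> (\<Sum>q=1..Q. dcos Q M q * exp (u q))"
proof -
  define t where "t i = (\<Sum>q=1..Q. dcos Q M q * (u q ^ i /\<^sub>R fact i))" for i
  have sums: "t sums (\<Sum>q=1..Q. dcos Q M q * exp (u q))"
    unfolding t_def by (intro sums_sum sums_mult exp_converges)
  have "t i = (\<Sum>q=1..Q. dcos Q M q * u q ^ i) / fact i" for i
    by (simp add: t_def sum_divide_distrib divide_inverse mult_ac sum_distrib_left)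
  then have "0 \<le> t i" for i
    using pos_corrD[OF assms] by simp
  then have "sum t {1} \<le> suminf t"
    by (intro sum_le_suminf sums_summable[OF sums]) auto
  then show ?thesis
    using sums_unique[OF sums] by (simp add: t_def)
qed

text \<open>In the linear term all cross-correlations \<open>c k\<close> are nonnegative, so only
  the diagonal contribution \<open>a n * c n\<close> is kept.\<close>

lemma corr_exp_ge_coeff:
  assumes Q: "1 \<le> Q" and A: "finite A" "n \<in> A" and a: "\<And>k. k \<in> A \<Longrightarrow> 0 \<le> a k"
  shows "a n \<le> (\<Sum>q=1..Q. dcos Q (F n) q * exp (\<Sum>k\<in>A. a k * dcos Q (F k) q))"
proof -
  define c where "c k = (\<Sum>q=1..Q. dcos Q (F n) q * dcos Q (F k) q)" for k
  have c_nonneg: "0 \<le> c k" for k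
    using pos_corrD[OF pos_corr_dcos_mult[OF pos_corr_one[OF Q]], of "F n" "F k"]
    by (simp add: c_def)
  \<comment> \<open>The single sample \<open>q = Q\<close> suffices: every discrete cosine equals 1
    there.\<close>
  have "(dcos Q (F n) Q)\<^sup>2 \<le> (\<Sum>q=1..Q. (dcos Q (F n) q)\<^sup>2)"
    using Q by (intro member_le_sum) auto
  then have "1 \<le> c n"
    using Q by (simp add: c_def dcos_period power2_eq_square)
  then have "a n \<le> a n * c n"
    using a[OF A(2)] by (simp add: mult_le_cancel_left1)
  also have "\<dots> \<le> (\<Sum>k\<in>A. a k * c k)"
    using A a c_nonneg by (intro member_le_sum) auto
  also have "\<dots> = (\<Sum>q=1..Q. dcos Q (F n) q * (\<Sum>k\<in>A. a k * dcos Q (F k) q))"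
    unfolding c_def sum_distrib_left by (subst sum.swap) (simp add: mult_ac)
  also have "\<dots> \<le> (\<Sum>q=1..Q. dcos Q (F n) q * exp (\<Sum>k\<in>A. a k * dcos Q (F k) q))"
    by (intro corr_exp_ge_linear pos_corr_power Q a)
  finally show ?thesis .
qed

section \<open>Lower bounds for the coefficients and iterates\<close>

lemma cos_ang_freq_sample:
  assumes "0 < \<Delta>f" and "f\<^sub>0 / \<Delta>f = of_int K"
  shows "cos (ang_freq f\<^sub>0 \<Delta>f n * (real q * sampling_step \<Delta>f Q)) = dcos Q (K + int n - 1) q"
proof -
  have "f\<^sub>0 = of_int K * \<Delta>f"
    using assms by (simp add: field_simps)
  \<comment> \<open>Every carrier frequency is an integer multiple of \<open>\<Delta>f\<close>, and
    this factor cancels against the period in the sampling step.\<close>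
  then have "ang_freq f\<^sub>0 \<Delta>f n = 2 * pi * of_int (K + int n - 1) * \<Delta>f"
    by (simp add: ang_freq_def algebra_simps)
  then have "ang_freq f\<^sub>0 \<Delta>f n * (real q * sampling_step \<Delta>f Q)
      = 2 * pi * of_int (K + int n - 1) * real q / real Q"
    using assms(1) by (simp add: sampling_step_def period_def)
  then show ?thesis
    by (simp only: dcos_def)
qed

text \<open>One factor \<open>c * h n\<close> of the square comes from the prefactor of
  \<open>coeff\<close>, the other from the weight of carrier \<open>n\<close> in the
  exponent.\<close>

lemma coeff_ge:
  fixes h s :: "nat \<Rightarrow> real"
  assumes "0 < R\<^sub>s" "0 < \<eta>" "0 < V\<^sub>0" "0 < \<Delta>f" "f\<^sub>0 / \<Delta>f \<in> \<int>" "1 \<le> Q"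
    and h: "\<And>k. k \<in> {1..N} \<Longrightarrow> 0 \<le> h k" and s: "\<And>k. k \<in> {1..N} \<Longrightarrow> 0 \<le> s k"
    and n: "n \<in> {1..N}"
  shows "(sqrt (2 * R\<^sub>s) / (\<eta> * V\<^sub>0) * h n)\<^sup>2 * s n / real Q
    \<le> coeff N R\<^sub>s \<eta> V\<^sub>0 h f\<^sub>0 \<Delta>f Q s n"
proof -
  obtain K where K: "f\<^sub>0 / \<Delta>f = of_int K"
    using assms(5) by (auto elim: Ints_cases)
  define c where "c = sqrt (2 * R\<^sub>s) / (\<eta> * V\<^sub>0)"
  define F where "F k = K + int k - 1" for k
  define a where "a k = c * s k * h k" for k
  note cos = cos_ang_freq_sample[OF assms(4) K, folded F_def]
  have c: "0 \<le> c"
    using assms(1-3) by (simp add: c_def)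
  have a_nonneg: "0 \<le> a k" if "k \<in> {1..N}" for k
    using that c h s by (simp add: a_def)
  have z: "zfun N R\<^sub>s \<eta> V\<^sub>0 h f\<^sub>0 \<Delta>f s (real q * sampling_step \<Delta>f Q)
      = exp (\<Sum>k=1..N. a k * dcos Q (F k) q)" for q
    unfolding zfun_def cos by (simp add: a_def c_def sum_distrib_left sum_divide_distrib mult_ac)
  have "coeff N R\<^sub>s \<eta> V\<^sub>0 h f\<^sub>0 \<Delta>f Q s n
      = c * h n / real Q * (\<Sum>q=1..Q. dcos Q (F n) q * exp (\<Sum>k=1..N. a k * dcos Q (F k) q))"
    unfolding coeff_def z cos c_def[symmetric] by (simp add: sum_distrib_left mult_ac)
  moreover have "a n \<le> (\<Sum>q=1..Q. dcos Q (F n) q * exp (\<Sum>k=1..N. a k * dcos Q (F k) q))"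
    using assms(6) n a_nonneg by (intro corr_exp_ge_coeff) auto
  then have "c * h n / real Q * a n
      \<le> c * h n / real Q * (\<Sum>q=1..Q. dcos Q (F n) q * exp (\<Sum>k=1..N. a k * dcos Q (F k) q))"
    using c h[OF n] by (intro mult_left_mono) auto
  moreover have "(c * h n)\<^sup>2 * s n / real Q = c * h n / real Q * a n"
    by (simp add: a_def power2_eq_square mult_ac)
  ultimately show ?thesis
    unfolding c_def by simp
qed

lemma scaled_pos:
  fixes \<beta> :: "nat \<Rightarrow> real"
  assumes "0 < P" "n \<in> {1..N}" "0 < \<beta> n"
  shows "0 < \<beta> n * sqrt (P / (\<Sum>k=1..N. (\<beta> k)\<^sup>2))"
proof -
  have "0 < (\<Sum>k=1..N. (\<beta> k)\<^sup>2)"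
    using assms by (intro sum_pos2[of _ n]) auto
  then show ?thesis
    using assms by simp
qed

text \<open>The lower bound in \<open>coeff_ge\<close> is proportional to \<open>s n\<close>, so an
  update preserves both signs; strict positivity is needed to keep the normalizing sum
  nonzero.\<close>

lemma iterate_nonneg_pos:
  fixes h :: "nat \<Rightarrow> real"
  assumes "0 < P\<^sub>T" "0 < R\<^sub>s" "0 < \<eta>" "0 < V\<^sub>0" "0 < \<Delta>f" "f\<^sub>0 / \<Delta>f \<in> \<int>" "1 \<le> Q"
    and h: "\<And>k. k \<in> {1..N} \<Longrightarrow> 0 \<le> h k"
    and n: "n \<in> {1..N}"
  shows "0 \<le> iterate N P\<^sub>T R\<^sub>s \<eta> V\<^sub>0 h f\<^sub>0 \<Delta>f Q (Suc m) n
    \<and> (0 < h n \<longrightarrow> 0 < iterate N P\<^sub>T R\<^sub>s \<eta> V\<^sub>0 h f\<^sub>0 \<Delta>f Q (Suc m) n)"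
  using n
proof (induction m arbitrary: n)
  case 0
  then show ?case using assms(1) by simp
next
  case (Suc m)
  define s where "s = iterate N P\<^sub>T R\<^sub>s \<eta> V\<^sub>0 h f\<^sub>0 \<Delta>f Q (Suc m)"
  define \<beta> where "\<beta> = coeff N R\<^sub>s \<eta> V\<^sub>0 h f\<^sub>0 \<Delta>f Q s"
  have ge: "(sqrt (2 * R\<^sub>s) / (\<eta> * V\<^sub>0) * h n)\<^sup>2 * s n / real Q \<le> \<beta> n"
    unfolding \<beta>_def using Suc by (intro coeff_ge assms h) (auto simp: s_def)
  have s: "0 \<le> s n" "0 < h n \<Longrightarrow> 0 < s n"
    using Suc by (auto simp: s_def)
  have "0 \<le> \<beta> n"
    by (rule order_trans[OF _ ge]) (use s in simp)
  moreover have "0 < \<beta> n" if "0 < h n"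
    by (rule less_le_trans[OF _ ge]) (use s that assms in simp)
  moreover have "iterate N P\<^sub>T R\<^sub>s \<eta> V\<^sub>0 h f\<^sub>0 \<Delta>f Q (Suc (Suc m)) n
      = \<beta> n * sqrt (P\<^sub>T / (\<Sum>k=1..N. (\<beta> k)\<^sup>2))"
    by (simp add: \<beta>_def s_def Let_def)
  ultimately show ?case
    using scaled_pos[of P\<^sub>T n N \<beta>] Suc.prems assms(1)
    by (auto intro!: mult_nonneg_nonneg sum_nonneg divide_nonneg_nonneg)
qed

section \<open>Maximizing a linear function over the nonnegative part of a ball\<close>

lemma is_arg_max_objective_iff:
  fixes \<beta> s\<^sub>m :: "nat \<Rightarrow> real"
  assumes P: "0 < P" and nonneg: "\<And>n. n \<in> {1..N} \<Longrightarrow> 0 \<le> \<beta> n"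
    and pos: "n\<^sub>0 \<in> {1..N}" "0 < \<beta> n\<^sub>0"
  shows "is_arg_max (objective N \<beta>\<^sub>0 \<beta> s\<^sub>m) (feasible N P) s \<longleftrightarrow>
    (\<forall>n\<in>{1..N}. s n = \<beta> n * sqrt (P / (\<Sum>k=1..N. (\<beta> k)\<^sup>2)))"
proof -
  define B where "B = (\<Sum>k=1..N. (\<beta> k)\<^sup>2)"
  define l where "l = sqrt (P / B)"
  define x where "x n = \<beta> n * l" for n
  have B: "0 < B"
    unfolding B_def using pos by (intro sum_pos2[of _ n\<^sub>0]) auto
  have l: "0 < l" "l\<^sup>2 * B = P"
    using P B by (auto simp: l_def)
  have norm_x: "(\<Sum>n=1..N. (x n)\<^sup>2) = P"
    unfolding l(2)[symmetric] B_def
    by (simp add: x_def power_mult_distrib sum_distrib_left mult_ac)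
  have feasible_x: "feasible N P x"
    using l nonneg norm_x by (auto simp: feasible_def x_def)
  \<comment> \<open>Since \<open>x = l * \<beta>\<close> has squared norm \<open>P\<close>, the
    squared distance equals \<open>|y|^2 - P\<close> plus \<open>2 * l\<close> times the objective
    gap, and feasibility makes \<open>|y|^2 - P\<close> nonpositive. This one inequality yields both
    optimality and uniqueness.\<close>
  have gap: "(\<Sum>n=1..N. (y n - x n)\<^sup>2)
      \<le> 2 * l * (objective N \<beta>\<^sub>0 \<beta> s\<^sub>m x - objective N \<beta>\<^sub>0 \<beta> s\<^sub>m y)" if "feasible N P y" for y
  proof -
    have "(\<Sum>n=1..N. (y n - x n)\<^sup>2)
        = (\<Sum>n=1..N. (y n)\<^sup>2 - (x n)\<^sup>2 + 2 * l * (\<beta> n * (x n - s\<^sub>m n) - \<beta> n * (y n - s\<^sub>m n)))"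
      by (intro sum.cong refl) (simp add: x_def power2_eq_square algebra_simps)
    also have "\<dots> = (\<Sum>n=1..N. (y n)\<^sup>2) - P
        + 2 * l * (objective N \<beta>\<^sub>0 \<beta> s\<^sub>m x - objective N \<beta>\<^sub>0 \<beta> s\<^sub>m y)"
      by (simp only: sum.distrib sum_subtractf sum_distrib_left[symmetric] norm_x objective_def)
        simp
    finally show ?thesis
      using that by (simp add: feasible_def)
  qed
  have eq_iff: "(\<Sum>n=1..N. (y n - x n)\<^sup>2) \<le> 0 \<longleftrightarrow> (\<forall>n\<in>{1..N}. y n = x n)" for y
  proof -
    have "0 \<le> (\<Sum>n=1..N. (y n - x n)\<^sup>2)"
      by (simp add: sum_nonneg)
    then have "(\<Sum>n=1..N. (y n - x n)\<^sup>2) \<le> 0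
        \<longleftrightarrow> (\<Sum>n=1..N. (y n - x n)\<^sup>2) = 0"
      by linarith
    then show ?thesis
      by (simp add: sum_nonneg_eq_0_iff)
  qed
  have "is_arg_max (objective N \<beta>\<^sub>0 \<beta> s\<^sub>m) (feasible N P) s \<longleftrightarrow> (\<forall>n\<in>{1..N}. s n = x n)"
  proof
    assume max: "is_arg_max (objective N \<beta>\<^sub>0 \<beta> s\<^sub>m) (feasible N P) s"
    then have "objective N \<beta>\<^sub>0 \<beta> s\<^sub>m x \<le> objective N \<beta>\<^sub>0 \<beta> s\<^sub>m s"
      using feasible_x by (auto simp: is_arg_max_def not_less)
    \<comment> \<open>A maximizer has nonpositive gap to \<open>x\<close>, which forces its squared
      distance from \<open>x\<close> to vanish.\<close>
    then have "2 * l * (objective N \<beta>\<^sub>0 \<beta> s\<^sub>m x - objective N \<beta>\<^sub>0 \<beta> s\<^sub>m s) \<le> 0"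
      using l(1) by (simp add: mult_nonneg_nonpos)
    then show "\<forall>n\<in>{1..N}. s n = x n"
      using order_trans[OF gap[of s]] max eq_iff[of s] by (simp add: is_arg_max_def)
  next
    assume eq: "\<forall>n\<in>{1..N}. s n = x n"
    have "feasible N P s \<longleftrightarrow> feasible N P x"
      using eq by (simp add: feasible_def)
    moreover have "objective N \<beta>\<^sub>0 \<beta> s\<^sub>m s = objective N \<beta>\<^sub>0 \<beta> s\<^sub>m x"
      using eq by (simp add: objective_def)
    moreover have "objective N \<beta>\<^sub>0 \<beta> s\<^sub>m y \<le> objective N \<beta>\<^sub>0 \<beta> s\<^sub>m x" if "feasible N P y" for y
    proof -
      have "0 \<le> 2 * l * (objective N \<beta>\<^sub>0 \<beta> s\<^sub>m x - objective N \<beta>\<^sub>0 \<beta> s\<^sub>m y)"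
        by (rule order_trans[OF sum_nonneg gap[OF that]]) simp
      then show ?thesis
        using l(1) by (simp add: zero_le_mult_iff)
    qed
    ultimately show "is_arg_max (objective N \<beta>\<^sub>0 \<beta> s\<^sub>m) (feasible N P) s"
      using feasible_x by (auto simp: is_arg_max_def not_less)
  qed
  then show ?thesis
    by (simp add: x_def l_def B_def)
qed

theorem proposition4p2:
  fixes N Q m :: nat
    and P\<^sub>T R\<^sub>s \<eta> V\<^sub>0 f_min f_max f\<^sub>0 \<Delta>f \<epsilon> \<beta>\<^sub>0 :: real
    and h s\<^sub>m \<beta> :: "nat \<Rightarrow> real"
  assumes "1 \<le> N" and "0 < P\<^sub>T" and "0 < R\<^sub>s" and "0 < \<eta>" and "0 < V\<^sub>0"
    and "\<forall>n\<in>{1..N}. 0 \<le> h n" and "\<exists>n\<in>{1..N}. h n \<noteq> 0"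
    and "0 < f_min" and "f_min < f_max"
    and "0 < \<Delta>f" and "f_min \<le> f\<^sub>0" and "f\<^sub>0 / \<Delta>f \<in> \<int>"
    and "f\<^sub>0 + (real N - 1) * \<Delta>f \<le> f_max"
    and "1 \<le> Q" and "0 < \<epsilon>"
    and "executes_iteration N P\<^sub>T R\<^sub>s \<eta> V\<^sub>0 h f\<^sub>0 \<Delta>f Q \<epsilon> m"
    and "s\<^sub>m = iterate N P\<^sub>T R\<^sub>s \<eta> V\<^sub>0 h f\<^sub>0 \<Delta>f Q m"
    and "\<beta>\<^sub>0 = coeff_zero N R\<^sub>s \<eta> V\<^sub>0 h f\<^sub>0 \<Delta>f Q s\<^sub>m"
    and "\<beta> = coeff N R\<^sub>s \<eta> V\<^sub>0 h f\<^sub>0 \<Delta>f Q s\<^sub>m"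
  shows "\<forall>s. is_arg_max (objective N \<beta>\<^sub>0 \<beta> s\<^sub>m) (feasible N P\<^sub>T) s \<longleftrightarrow>
           (\<forall>n\<in>{1..N}. s n = \<beta> n * sqrt (P\<^sub>T / (\<Sum>k=1..N. (\<beta> k)\<^sup>2)))"
proof -
  \<comment> \<open>Iterates are specified only from index 1 on, and an executed iteration has
    \<open>m \<ge> 1\<close>.\<close>
  obtain m' where m: "m = Suc m'"
    using assms(16) by (cases m) (auto simp: executes_iteration_def)
  have h: "\<And>k. k \<in> {1..N} \<Longrightarrow> 0 \<le> h k"
    using assms(6) by blast
  have s: "0 \<le> s\<^sub>m n" "0 < h n \<Longrightarrow> 0 < s\<^sub>m n" if "n \<in> {1..N}" for n
    using iterate_nonneg_pos[OF assms(2-5,10,12,14) h that, where m = m'] by (auto simp: assms(17) m)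
  have ge: "(sqrt (2 * R\<^sub>s) / (\<eta> * V\<^sub>0) * h n)\<^sup>2 * s\<^sub>m n / real Q \<le> \<beta> n"
    if "n \<in> {1..N}" for n
    unfolding assms(19) by (intro coeff_ge assms(3-5,10,12,14) h s(1) that)
  \<comment> \<open>A channel with nonzero amplitude supplies the positive coefficient that makes
    the denominator under the square root positive.\<close>
  obtain n\<^sub>0 where n\<^sub>0: "n\<^sub>0 \<in> {1..N}" "h n\<^sub>0 \<noteq> 0"
    using assms(7) by blast
  have h\<^sub>0: "0 < h n\<^sub>0"
    using n\<^sub>0 h[of n\<^sub>0] by simp
  have "0 \<le> \<beta> n" if "n \<in> {1..N}" for n
    by (rule order_trans[OF _ ge[OF that]]) (use s that in auto)
  moreover have "0 < \<beta> n\<^sub>0"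
    by (rule less_le_trans[OF _ ge[OF n\<^sub>0(1)]]) (use s n\<^sub>0 h\<^sub>0 assms in auto)
  ultimately show ?thesis
    using is_arg_max_objective_iff[OF assms(2) _ n\<^sub>0(1)] by blast
qed

end
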